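(* Let $K\subset\mathbb{R}^3$ be the unit ball of the norm $\|(x,y,z)\|=|x|+\max\{|y|,|z|\}$, and let $(X,Y,Z)$ be uniformly distributed on $K$ (with respect to normalized Lebesgue measure on $K$). Then for any symmetric (i.e. even) functions $f,g:\mathbb{R}\to\mathbb{R}$ that are (strictly) increasing on $[0,\infty)$, $$\operatorname{cov}(f(Y),g(Z))>0.$$ In particular, $\operatorname{cov}(Y^2,Z^2)>0$.
   Context: $\operatorname{cov}(U,V)=\mathbb{E}(UV)-\mathbb{E}U\,\mathbb{E}V$. *)

theory Defs
  imports "HOL-Probability.Probability"
begin

definition mixed_norm :: "real \<times> real \<times> real \<Rightarrow> real" where
  "mixed_norm = (\<lambda>(x, y, z). \<bar>x\<bar> + max \<bar>y\<bar> \<bar>z\<bar>)"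

definition mixed_ball :: "(real \<times> real \<times> real) set" where
  "mixed_ball = {p. mixed_norm p \<le> 1}"

context prob_space
begin

(* Bochner integrals default to 0: the value is meaningful only when U, V and their product are
   integrable (e.g. when U and V are measurable and almost surely bounded). *)
definition cov :: "('a \<Rightarrow> real) \<Rightarrow> ('a \<Rightarrow> real) \<Rightarrow> real" where
  "cov U V = expectation (\<lambda>\<omega>. U \<omega> * V \<omega>) - expectation U * expectation V"

end

end

theory Submission
  imports Defs
begin

text \<open>
  Given \<open>X = x\<close>, the pair \<open>(Y, Z)\<close> is uniform on the square \<open>{-r..r} \<times> {-r..r}\<close> with
  \<open>r = 1 - \<bar>x\<bar>\<close>, because \<open>\<bar>x\<bar> + max \<bar>y\<bar> \<bar>z\<bar> \<le> 1\<close> bounds \<open>y\<close> and \<open>z\<close> separately. So \<open>Y\<close>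
  and \<open>Z\<close> are conditionally independent given \<open>X\<close>, and all their dependence comes from the common
  random scale \<open>R = 1 - \<bar>X\<bar>\<close>. Writing \<open>sym_average f r\<close> for the mean of \<open>f\<close> over \<open>{-r..r}\<close>, this
  reads (\<open>expectation_mixed_ball\<close>)
  \<open>E (f Y * g Z) = E (sym_average f R * sym_average g R)\<close>.
  Taking \<open>g = 1\<close> or \<open>f = 1\<close> gives the two single expectations, hence
  \<open>cov (f Y) (g Z) = cov (sym_average f R) (sym_average g R)\<close>.

  For \<open>f\<close> even and strictly increasing on \<open>{0..}\<close> the average \<open>sym_average f r\<close> is strictly
  increasing in \<open>r\<close> (\<open>strict_mono_sym_average\<close>), since it is the mean of \<open>f (r * \<bar>U\<bar>)\<close> for \<open>U\<close>
  uniform on \<open>{-1..1}\<close>. Two strictly increasing functions of one atomless random variable have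
  positive covariance by Chebyshev's association inequality (\<open>cov_strict_mono_pos\<close>).
\<close>

section \<open>Covariance of two increasing functions of one random variable\<close>

text \<open>
  Chebyshev's association inequality in strict form. A constant subtracted from \<open>G R\<close> does not
  change \<open>E ((F R - E (F R)) * G R)\<close>, so that \<open>cov\<close> is the expectation of
  \<open>(F R - E (F R)) * (G R - G r\<^sub>0)\<close> for every \<open>r\<^sub>0\<close>. If \<open>r\<^sub>0\<close> is the point where \<open>F\<close> crosses its mean,
  both factors have the same sign and vanish at most at \<open>R = r\<^sub>0\<close>.
\<close>
lemma (in prob_space) cov_strict_mono_pos:
  fixes R :: "'a \<Rightarrow> real" and F G :: "real \<Rightarrow> real"
  assumes F: "strict_mono_on {a..b} F" and G: "strict_mono_on {a..b} G"
    and [measurable]: "R \<in> borel_measurable M" "F \<in> borel_measurable borel" "G \<in> borel_measurable borel"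
    and R: "AE \<omega> in M. R \<omega> \<in> {a..b}"
    and no_atom: "\<And>r. AE \<omega> in M. R \<omega> \<noteq> r"
  shows "cov (\<lambda>\<omega>. F (R \<omega>)) (\<lambda>\<omega>. G (R \<omega>)) > 0"
proof -
  have "a \<le> b"
  proof (rule ccontr)
    assume "\<not> a \<le> b"
    with R show False by auto
  qed
  have bound: "\<bar>H r\<bar> \<le> max \<bar>H a\<bar> \<bar>H b\<bar>"
    if "strict_mono_on {a..b} H" "r \<in> {a..b}" for H :: "real \<Rightarrow> real" and r
    using strict_mono_on_leD[OF that(1), of a r] strict_mono_on_leD[OF that(1), of r b] that(2)
    by auto
  have int: "integrable M (\<lambda>\<omega>. H (R \<omega>))"
    if "strict_mono_on {a..b} H" and [measurable]: "H \<in> borel_measurable borel" for H :: "real \<Rightarrow> real"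
  proof (rule integrable_const_bound)
    show "AE \<omega> in M. norm (H (R \<omega>)) \<le> max \<bar>H a\<bar> \<bar>H b\<bar>"
      using R by eventually_elim (simp only: real_norm_def bound[OF that(1)])
  qed simp
  note int = int[OF F] int[OF G]
  have intFG: "integrable M (\<lambda>\<omega>. F (R \<omega>) * G (R \<omega>))"
  proof (rule integrable_const_bound)
    show "AE \<omega> in M. norm (F (R \<omega>) * G (R \<omega>)) \<le> max \<bar>F a\<bar> \<bar>F b\<bar> * max \<bar>G a\<bar> \<bar>G b\<bar>"
      using R
    proof eventually_elim
      case (elim \<omega>)
      show ?case
        unfolding real_norm_def abs_mult
        by (intro mult_mono bound[OF F elim] bound[OF G elim]) (auto simp: le_max_iff_disj)
    qed
  qed simp
  define m where "m = expectation (\<lambda>\<omega>. F (R \<omega>))"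
  \<comment> \<open>Inserting \<open>a\<close> makes the set nonempty outright; \<open>below\<close> only uses members that exceed \<open>a\<close>.\<close>
  define S where "S = insert a {r \<in> {a..b}. F r \<le> m}"
  define r0 where "r0 = Sup S"
  have S: "S \<noteq> {}" "S \<subseteq> {a..b}"
    using \<open>a \<le> b\<close> by (auto simp: S_def)
  have bdd: "bdd_above S"
    using S(2) by (rule bdd_above_mono[OF bdd_above_Icc])
  have r0: "r0 \<in> {a..b}"
  proof -
    have "r0 \<le> b"
      unfolding r0_def using S by (intro cSup_least) auto
    moreover have "a \<le> r0"
      unfolding r0_def using bdd by (intro cSup_upper) (simp add: S_def)
    ultimately show ?thesis by simp
  qed
  have above: "m < F r" if "r \<in> {a..b}" "r0 < r" for r
  proof (rule ccontr)
    assume "\<not> m < F r"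
    then have "r \<in> S"
      using that(1) by (simp add: S_def)
    then have "r \<le> r0"
      unfolding r0_def using bdd by (intro cSup_upper)
    with that(2) show False by simp
  qed
  have below: "F r < m" if r: "r \<in> {a..b}" "r < r0" for r
  proof -
    obtain s where s: "s \<in> S" "r < s"
      using less_cSupD[OF S(1)] r(2) unfolding r0_def by blast
    then have "s \<in> {a..b}" "F s \<le> m"
      using r S(2) by (auto simp: S_def)
    then show ?thesis
      using strict_mono_onD[OF F r(1) _ s(2)] by auto
  qed
  have pos: "AE \<omega> in M. 0 < (F (R \<omega>) - m) * (G (R \<omega>) - G r0)"
    using R no_atom[of r0]
  proof eventually_elim
    case (elim \<omega>)
    then consider "R \<omega> < r0" | "r0 < R \<omega>" by linarith
    then show ?case
    proof cases
      case 1
      then show ?thesis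
        using below[OF elim(1)] strict_mono_onD[OF G elim(1) r0] by (intro mult_neg_neg) auto
    next
      case 2
      then show ?thesis
        using above[OF elim(1)] strict_mono_onD[OF G r0 elim(1)] by (intro mult_pos_pos) auto
    qed
  qed
  have expand: "(\<lambda>\<omega>. (F (R \<omega>) - m) * (G (R \<omega>) - G r0)) =
      (\<lambda>\<omega>. F (R \<omega>) * G (R \<omega>) - G r0 * F (R \<omega>) - m * G (R \<omega>) + m * G r0)"
    by (auto simp: algebra_simps)
  have "integrable M (\<lambda>\<omega>. (F (R \<omega>) - m) * (G (R \<omega>) - G r0))"
    unfolding expand using int intFG by auto
  then have "expectation (\<lambda>\<omega>. 0) < expectation (\<lambda>\<omega>. (F (R \<omega>) - m) * (G (R \<omega>) - G r0))"
    using pos by (intro integral_less_AE_space) (auto simp: emeasure_space_1)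
  also have "\<dots> = cov (\<lambda>\<omega>. F (R \<omega>)) (\<lambda>\<omega>. G (R \<omega>))"
    unfolding expand cov_def using int intFG by (simp add: m_def prob_space)
  finally show ?thesis by simp
qed

section \<open>Averages over symmetric intervals\<close>

lemma integral_uniform_measure:
  fixes f :: "'a \<Rightarrow> real"
  assumes A: "emeasure M A \<noteq> 0" "emeasure M A \<noteq> \<infinity>" and [measurable]: "f \<in> borel_measurable M"
  shows "integral\<^sup>L (uniform_measure M A) f = (\<integral>x. indicator A x * f x \<partial>M) / measure M A"
proof -
  have [measurable]: "A \<in> sets M"
    using A(1) by (rule emeasure_neq_0_sets)
  have eq: "emeasure M A = ennreal (measure M A)"
    using A(2) by (intro emeasure_eq_ennreal_measure) simp
  have pos: "measure M A > 0"
    using A(1) eq by (metis ennreal_0 measure_nonneg order_le_less)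
  have "uniform_measure M A = density M (\<lambda>x. ennreal (indicator A x / measure M A))"
    unfolding uniform_measure_def eq using pos
    by (intro density_cong) (auto simp: divide_ennreal[of 1, simplified] split: split_indicator)
  then have "integral\<^sup>L (uniform_measure M A) f = (\<integral>x. indicator A x / measure M A * f x \<partial>M)"
    by (simp add: integral_density)
  also have "\<dots> = (\<integral>x. indicator A x * f x / measure M A \<partial>M)" by simp
  finally show ?thesis by (simp only: integral_divide_zero)
qed

text \<open>
  For \<open>r > 0\<close> this is the mean of \<open>f\<close> over \<open>{-r..r}\<close> (\<open>integral_sym_interval\<close>). Scaling a fixed
  uniform variable makes averages for different \<open>r\<close> comparable pointwise, and gives the right
  value \<open>f 0\<close> at \<open>r = 0\<close>.
\<close>
definition sym_average :: "(real \<Rightarrow> real) \<Rightarrow> real \<Rightarrow> real" where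
  "sym_average f r = (\<integral>u. f (r * u) \<partial>uniform_measure lborel {-1..1})"

interpretation unif: prob_space "uniform_measure lborel {-1..1::real}"
  by (rule prob_space_uniform_measure) auto

lemma AE_unif: "(AE u in uniform_measure lborel {-1..1::real}. P u) \<longleftrightarrow>
    (AE u in lborel. u \<in> {-1..1} \<longrightarrow> P u)"
  by (rule AE_uniform_measure) auto

lemma borel_measurable_sym_average [measurable]:
  assumes [measurable]: "f \<in> borel_measurable borel"
  shows "sym_average f \<in> borel_measurable borel"
  unfolding sym_average_def by measurable

lemma sym_average_const [simp]: "sym_average (\<lambda>_. c) r = c"
  using unif.prob_space by (simp add: sym_average_def)

lemma abs_mult_le_1: "\<bar>r * u\<bar> \<le> 1" if "\<bar>r\<bar> \<le> 1" "\<bar>u\<bar> \<le> 1" for r u :: real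
  using mult_mono[OF that] by (simp add: abs_mult)

lemma integrable_sym_average:
  fixes f :: "real \<Rightarrow> real"
  assumes [measurable]: "f \<in> borel_measurable borel" and B: "\<And>t. \<bar>t\<bar> \<le> 1 \<Longrightarrow> \<bar>f t\<bar> \<le> B" and r: "\<bar>r\<bar> \<le> 1"
  shows "integrable (uniform_measure lborel {-1..1}) (\<lambda>u. f (r * u))"
  by (rule unif.integrable_const_bound[where B=B])
     (auto simp: AE_unif intro!: AE_I2 B abs_mult_le_1 r)

lemma sym_average_bound:
  fixes f :: "real \<Rightarrow> real"
  assumes [measurable]: "f \<in> borel_measurable borel" and B: "\<And>t. \<bar>t\<bar> \<le> 1 \<Longrightarrow> \<bar>f t\<bar> \<le> B" and r: "\<bar>r\<bar> \<le> 1"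
  shows "\<bar>sym_average f r\<bar> \<le> B"
proof -
  have "\<bar>sym_average f r\<bar> \<le> (\<integral>u. \<bar>f (r * u)\<bar> \<partial>uniform_measure lborel {-1..1})"
    unfolding sym_average_def by (rule integral_abs_bound)
  also have "\<dots> \<le> (\<integral>u. B \<partial>uniform_measure lborel {-1..1::real})"
    using integrable_sym_average[OF assms]
    by (intro integral_mono_AE) (auto simp: AE_unif intro!: AE_I2 B abs_mult_le_1 r)
  finally show ?thesis using unif.prob_space by simp
qed

lemma integral_sym_interval:
  assumes [measurable]: "f \<in> borel_measurable borel" and "r > 0"
  shows "(\<integral>y. indicator {-r..r} y * f y \<partial>lborel) = 2 * r * sym_average f r"
proof -
  have "(\<integral>y. indicator {-r..r} y * f y \<partial>lborel) =
      r * (\<integral>u. indicator {-r..r} (r * u) * f (r * u) \<partial>lborel)"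
    using lborel_integral_real_affine[of r "\<lambda>y. indicator {-r..r} y * f y" 0] \<open>r > 0\<close> by simp
  also have "(\<lambda>u. indicator {-r..r} (r * u) * f (r * u)) = (\<lambda>u. indicator {-1..1} u * f (r * u))"
  proof
    fix u
    have "r * u \<in> {-r..r} \<longleftrightarrow> u \<in> {-1..1}"
      using mult_le_cancel_left_pos[OF \<open>r > 0\<close>, of "-1" u] mult_le_cancel_left_pos[OF \<open>r > 0\<close>, of u 1]
      by simp
    then show "indicator {-r..r} (r * u) * f (r * u) = indicator {-1..1} u * f (r * u)"
      by (simp add: indicator_def)
  qed
  also have "(\<integral>u. indicator {-1..1} u * f (r * u) \<partial>lborel) = 2 * sym_average f r"
    unfolding sym_average_def by (subst integral_uniform_measure) auto
  finally show ?thesis by simp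
qed

text \<open>
  For \<open>r < s\<close> the integrands compare strictly, \<open>f (r * \<bar>u\<bar>) < f (s * \<bar>u\<bar>)\<close>, at every \<open>u\<close> but \<open>0\<close>.
\<close>
lemma strict_mono_sym_average:
  assumes even: "\<And>t. f (- t) = f t" and mono: "strict_mono_on {0..} f"
    and [measurable]: "f \<in> borel_measurable borel" and B: "\<And>t. \<bar>t\<bar> \<le> 1 \<Longrightarrow> \<bar>f t\<bar> \<le> B"
  shows "strict_mono_on {0..1} (sym_average f)"
proof (rule strict_mono_onI)
  fix r s :: real assume rs: "r \<in> {0..1}" "s \<in> {0..1}" "r < s"
  have abs: "f t = f \<bar>t\<bar>" for t
    using even[of t] by (auto simp: abs_if)
  have "f (r * u) < f (s * u)" if "u \<noteq> 0" for u
    using rs that unfolding abs[of "r * u"] abs[of "s * u"]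
    by (intro strict_mono_onD[OF mono]) (auto simp: abs_mult)
  then have "AE u in uniform_measure lborel {-1..1}. f (r * u) < f (s * u)"
    using AE_lborel_singleton[of "0::real"] by (auto simp: AE_unif elim!: eventually_mono)
  then show "sym_average f r < sym_average f s"
    unfolding sym_average_def using rs
    by (intro unif.integral_less_AE_space integrable_sym_average[OF _ B])
       (auto simp: unif.emeasure_space_1)
qed

lemma even_mono_measurable:
  fixes f :: "real \<Rightarrow> real"
  assumes even: "\<And>t. f (- t) = f t" and mono: "mono_on {0..} f"
  shows "f \<in> borel_measurable borel"
proof -
  have "mono (\<lambda>t. f (max 0 t))"
    by (intro monoI mono_onD[OF mono]) auto
  then have [measurable]: "(\<lambda>t. f (max 0 t)) \<in> borel_measurable borel"
    by (rule borel_measurable_mono)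
  have "(\<lambda>t. f (max 0 \<bar>t\<bar>)) \<in> borel_measurable borel"
    by measurable
  also have "(\<lambda>t. f (max 0 \<bar>t\<bar>)) = f"
    using even by (auto simp: fun_eq_iff abs_if)
  finally show ?thesis .
qed

lemma even_mono_bounded:
  fixes f :: "real \<Rightarrow> real"
  assumes even: "\<And>t. f (- t) = f t" and mono: "mono_on {0..} f" and t: "\<bar>t\<bar> \<le> 1"
  shows "\<bar>f t\<bar> \<le> max \<bar>f 0\<bar> \<bar>f 1\<bar>"
proof -
  have "f t = f \<bar>t\<bar>"
    using even[of t] by (auto simp: abs_if)
  then show ?thesis
    using mono_onD[OF mono, of 0 "\<bar>t\<bar>"] mono_onD[OF mono, of "\<bar>t\<bar>" 1] t by auto
qed

section \<open>The ball\<close>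

lemma mixed_ball_iff: "(x, y, z) \<in> mixed_ball \<longleftrightarrow> y \<in> {-(1-\<bar>x\<bar>)..1-\<bar>x\<bar>} \<and> z \<in> {-(1-\<bar>x\<bar>)..1-\<bar>x\<bar>}"
  by (auto simp: mixed_ball_def mixed_norm_def)

lemma mixed_ball_measurable [measurable]: "mixed_ball \<in> sets borel"
proof -
  have "mixed_ball = {p :: real \<times> real \<times> real. \<bar>fst p\<bar> + max \<bar>fst (snd p)\<bar> \<bar>snd (snd p)\<bar> \<le> 1}"
    by (auto simp: mixed_ball_def mixed_norm_def)
  also have "closed \<dots>"
    by (intro closed_Collect_le continuous_intros)
  finally show ?thesis by (rule borel_closed)
qed

lemma mixed_ball_finite: "emeasure lborel mixed_ball < \<infinity>"
proof -
  have "mixed_ball \<subseteq> cbox (-1, -1, -1) (1, 1, 1)"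
    by (auto simp: mixed_ball_def mixed_norm_def)
  then have "emeasure lborel mixed_ball \<le> emeasure lborel (cbox (-1, -1, -1) (1, 1, 1 :: real) :: (real \<times> real \<times> real) set)"
    by (intro emeasure_mono) auto
  also have "\<dots> < \<infinity>"
    by (rule emeasure_lborel_cbox_finite)
  finally show ?thesis .
qed

text \<open>
  The slice of the ball at \<open>x\<close> is a square, so the integral over the slice of a product
  \<open>\<phi> y * \<psi> z\<close> factors. The weight \<open>(2 * (1 - \<bar>x\<bar>))\<^sup>2\<close> is the area of the slice. The factor \<open>\<theta> x\<close>
  is there so that the same formula also evaluates integrals of functions of \<open>x\<close> alone.
\<close>
lemma integral_mixed_ball:
  fixes \<theta> \<phi> \<psi> :: "real \<Rightarrow> real"
  assumes [measurable]: "\<theta> \<in> borel_measurable borel" "\<phi> \<in> borel_measurable borel" "\<psi> \<in> borel_measurable borel"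
    and A: "\<And>t. \<bar>t\<bar> \<le> 1 \<Longrightarrow> \<bar>\<theta> t\<bar> \<le> A"
    and B: "\<And>t. \<bar>t\<bar> \<le> 1 \<Longrightarrow> \<bar>\<phi> t\<bar> \<le> B"
    and C: "\<And>t. \<bar>t\<bar> \<le> 1 \<Longrightarrow> \<bar>\<psi> t\<bar> \<le> C"
  shows "(\<integral>(x, y, z). indicator mixed_ball (x, y, z) * (\<theta> x * \<phi> y * \<psi> z) \<partial>lborel) =
    (\<integral>x. indicator {-1<..<1} x * (2 * (1 - \<bar>x\<bar>))\<^sup>2 *
      (\<theta> x * sym_average \<phi> (1 - \<bar>x\<bar>) * sym_average \<psi> (1 - \<bar>x\<bar>)) \<partial>lborel)"
proof -
  define a where "a f x y = indicator {-(1-\<bar>x\<bar>)..1-\<bar>x\<bar>} y * f y" for f :: "real \<Rightarrow> real" and x y :: real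
  have a_int: "integrable lborel (a f x)"
    if [measurable]: "f \<in> borel_measurable borel" and D: "\<And>t. \<bar>t\<bar> \<le> 1 \<Longrightarrow> \<bar>f t\<bar> \<le> D" for f x D
  proof -
    have "AE t in lborel. t \<in> {-(1-\<bar>x\<bar>)..1-\<bar>x\<bar>} \<longrightarrow> norm (f t) \<le> D"
      using D by (intro AE_I2) auto
    then show ?thesis
      unfolding a_def using integrableI_bounded_set_indicator[of "{-(1-\<bar>x\<bar>)..1-\<bar>x\<bar>}" lborel f D]
      by (auto simp: emeasure_lborel_Icc_eq)
  qed
  have a_val: "(\<integral>y. a f x y \<partial>lborel) = 2 * (1 - \<bar>x\<bar>) * sym_average f (1 - \<bar>x\<bar>)"
    if "\<bar>x\<bar> < 1" "f \<in> borel_measurable borel" for f x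
    unfolding a_def using that by (intro integral_sym_interval) auto
  \<comment> \<open>At \<open>\<bar>x\<bar> = 1\<close> the slice is a point, where the scaling in \<open>integral_sym_interval\<close> breaks down.\<close>
  have AE_x: "AE x in lborel. \<bar>x\<bar> \<noteq> (1 :: real)"
    using AE_lborel_singleton[of "1::real"] AE_lborel_singleton[of "-1::real"]
    by eventually_elim auto
  have split: "indicator mixed_ball (x, y, z) * (\<theta> x * \<phi> y * \<psi> z) = \<theta> x * (a \<phi> x y * a \<psi> x z)" for x y z
    by (auto simp: a_def mixed_ball_iff split: split_indicator)
  have inner: "(\<integral>(y, z). indicator mixed_ball (x, y, z) * (\<theta> x * \<phi> y * \<psi> z) \<partial>(lborel \<Otimes>\<^sub>M lborel)) =
      \<theta> x * ((\<integral>y. a \<phi> x y \<partial>lborel) * (\<integral>z. a \<psi> x z \<partial>lborel))" for x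
  proof -
    have "integrable (lborel \<Otimes>\<^sub>M lborel) (\<lambda>(y, z). a \<phi> x y * a \<psi> x z)"
      using a_int[of \<phi> B x] a_int[of \<psi> C x] B C
      by (intro lborel_pair.Fubini_integrable) (auto simp: abs_mult integrable_abs)
    then have "(\<integral>(y, z). a \<phi> x y * a \<psi> x z \<partial>(lborel \<Otimes>\<^sub>M lborel)) =
        (\<integral>y. (\<integral>z. a \<phi> x y * a \<psi> x z \<partial>lborel) \<partial>lborel)"
      using lborel_pair.integral_fst'[of "\<lambda>(y, z). a \<phi> x y * a \<psi> x z"] by simp
    then show ?thesis
      by (simp add: split case_prod_unfold)
  qed
  have "integrable lborel (\<lambda>p. indicator mixed_ball p *\<^sub>R (\<theta> (fst p) * \<phi> (fst (snd p)) * \<psi> (snd (snd p))))"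
  proof (rule integrableI_bounded_set_indicator[where B="A * B * C"])
    show "AE p in lborel. p \<in> mixed_ball \<longrightarrow>
        norm (\<theta> (fst p) * \<phi> (fst (snd p)) * \<psi> (snd (snd p))) \<le> A * B * C"
    proof (intro AE_I2 impI)
      fix p :: "real \<times> real \<times> real" assume "p \<in> mixed_ball"
      then have "\<bar>fst p\<bar> \<le> 1" "\<bar>fst (snd p)\<bar> \<le> 1" "\<bar>snd (snd p)\<bar> \<le> 1"
        by (cases p; auto simp: mixed_ball_def mixed_norm_def)+
      then show "norm (\<theta> (fst p) * \<phi> (fst (snd p)) * \<psi> (snd (snd p))) \<le> A * B * C"
        unfolding real_norm_def abs_mult
        using A[of 0] B[of 0] C[of 0] by (intro mult_mono A B C) auto
    qed
    show "mixed_ball \<in> sets lborel" by simp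
    show "(\<lambda>p. \<theta> (fst p) * \<phi> (fst (snd p)) * \<psi> (snd (snd p))) \<in> borel_measurable lborel"
      unfolding lborel_prod[symmetric] by measurable
  qed (rule mixed_ball_finite)
  then have "integrable (lborel \<Otimes>\<^sub>M (lborel \<Otimes>\<^sub>M lborel))
      (\<lambda>(x, y, z). indicator mixed_ball (x, y, z) * (\<theta> x * \<phi> y * \<psi> z))"
    by (simp add: lborel_prod case_prod_unfold)
  then have "(\<integral>(x, y, z). indicator mixed_ball (x, y, z) * (\<theta> x * \<phi> y * \<psi> z) \<partial>lborel) =
      (\<integral>x. (\<integral>(y, z). indicator mixed_ball (x, y, z) * (\<theta> x * \<phi> y * \<psi> z) \<partial>(lborel \<Otimes>\<^sub>M lborel)) \<partial>lborel)"
    using lborel_pair.integral_fst'[of "\<lambda>(x, y, z). indicator mixed_ball (x, y, z) * (\<theta> x * \<phi> y * \<psi> z)"]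
    by (simp add: lborel_prod)
  also have "\<dots> = (\<integral>x. \<theta> x * ((\<integral>y. a \<phi> x y \<partial>lborel) * (\<integral>z. a \<psi> x z \<partial>lborel)) \<partial>lborel)"
    by (simp only: inner)
  also have "\<dots> = (\<integral>x. indicator {-1<..<1} x * (2 * (1 - \<bar>x\<bar>))\<^sup>2 *
      (\<theta> x * sym_average \<phi> (1 - \<bar>x\<bar>) * sym_average \<psi> (1 - \<bar>x\<bar>)) \<partial>lborel)"
  proof (rule integral_cong_AE)
    have zero: "a f x y = 0" if "\<bar>x\<bar> > 1" for f x y
      using that by (auto simp: a_def)
    show "AE x in lborel. \<theta> x * ((\<integral>y. a \<phi> x y \<partial>lborel) * (\<integral>z. a \<psi> x z \<partial>lborel)) =
      indicator {-1<..<1} x * (2 * (1 - \<bar>x\<bar>))\<^sup>2 *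
      (\<theta> x * sym_average \<phi> (1 - \<bar>x\<bar>) * sym_average \<psi> (1 - \<bar>x\<bar>))"
      using AE_x
    proof eventually_elim
      case (elim x)
      then consider "\<bar>x\<bar> < 1" | "\<bar>x\<bar> > 1" by linarith
      then show ?case
      proof cases
        case 1
        then have "x \<in> {-1<..<1}" by auto
        with 1 show ?thesis
          by (simp add: a_val power2_eq_square)
      next
        case 2
        then have "x \<notin> {-1<..<1}" by auto
        with 2 show ?thesis
          by (simp add: zero)
      qed
    qed
  qed (unfold a_def atLeastAtMost_iff indicator_def, measurable)
  finally show ?thesis .
qed

section \<open>Conditioning on the first coordinate\<close>

text \<open>
  In the language of conditioning, \<open>sym_average \<phi> (1 - \<bar>X\<bar>)\<close> is the conditional expectation of
  \<open>\<phi> Y\<close> given \<open>X\<close>, and the conditional expectation of the product is the product of the two. The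
  proof stays elementary: \<open>integral_mixed_ball\<close>, applied once to \<open>\<phi> y * \<psi> z\<close> and once to the
  corresponding function of \<open>x\<close> alone, gives the same integral over \<open>x\<close>.
\<close>
lemma (in prob_space) expectation_mixed_ball:
  fixes X Y Z :: "'a \<Rightarrow> real"
  assumes [measurable]: "X \<in> borel_measurable M" "Y \<in> borel_measurable M" "Z \<in> borel_measurable M"
    and D: "distr M lborel (\<lambda>\<omega>. (X \<omega>, Y \<omega>, Z \<omega>)) = uniform_measure lborel mixed_ball"
    and [measurable]: "\<phi> \<in> borel_measurable borel" "\<psi> \<in> borel_measurable borel"
    and B: "\<And>t. \<bar>t\<bar> \<le> 1 \<Longrightarrow> \<bar>\<phi> t\<bar> \<le> B" and C: "\<And>t. \<bar>t\<bar> \<le> 1 \<Longrightarrow> \<bar>\<psi> t\<bar> \<le> C"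
  shows "expectation (\<lambda>\<omega>. \<phi> (Y \<omega>) * \<psi> (Z \<omega>)) =
    expectation (\<lambda>\<omega>. sym_average \<phi> (1 - \<bar>X \<omega>\<bar>) * sym_average \<psi> (1 - \<bar>X \<omega>\<bar>))"
proof -
  have T [measurable]: "(\<lambda>\<omega>. (X \<omega>, Y \<omega>, Z \<omega>)) \<in> measurable M lborel"
    by simp
  \<comment> \<open>If the ball were null, its uniform measure would be the zero measure, which is not the
    distribution of a random variable.\<close>
  have nz: "emeasure lborel mixed_ball \<noteq> 0"
  proof
    assume 0: "emeasure lborel mixed_ball = 0"
    interpret d: prob_space "uniform_measure lborel mixed_ball"
      unfolding D[symmetric] by (rule prob_space_distr) (rule T)
    show False
      using d.emeasure_space_1 0 by (simp add: emeasure_uniform_measure)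
  qed
  have E: "expectation (\<lambda>\<omega>. \<theta> (X \<omega>) * \<phi> (Y \<omega>) * \<psi> (Z \<omega>)) =
      (\<integral>(x, y, z). indicator mixed_ball (x, y, z) * (\<theta> x * \<phi> y * \<psi> z) \<partial>lborel) / measure lborel mixed_ball"
    if [measurable]: "\<theta> \<in> borel_measurable borel" "\<phi> \<in> borel_measurable borel" "\<psi> \<in> borel_measurable borel"
    for \<theta> \<phi> \<psi> :: "real \<Rightarrow> real"
  proof -
    have m: "(\<lambda>p. \<theta> (fst p) * \<phi> (fst (snd p)) * \<psi> (snd (snd p))) \<in> borel_measurable lborel"
      unfolding lborel_prod[symmetric] by measurable
    show ?thesis
      using integral_distr[OF T m] integral_uniform_measure[OF nz _ m] mixed_ball_finite
      by (simp add: D case_prod_unfold)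
  qed
  have r: "\<bar>1 - \<bar>t\<bar>\<bar> \<le> 1" if "\<bar>t\<bar> \<le> 1" for t :: real
    using that by auto
  have "expectation (\<lambda>\<omega>. \<phi> (Y \<omega>) * \<psi> (Z \<omega>)) =
      (\<integral>x. indicator {-1<..<1} x * (2 * (1 - \<bar>x\<bar>))\<^sup>2 *
      (1 * sym_average \<phi> (1 - \<bar>x\<bar>) * sym_average \<psi> (1 - \<bar>x\<bar>)) \<partial>lborel) / measure lborel mixed_ball"
    using E[of "\<lambda>_. 1" \<phi> \<psi>] integral_mixed_ball[of "\<lambda>_. 1" \<phi> \<psi> 1 B C] B C by simp
  also have "\<dots> = expectation (\<lambda>\<omega>. (sym_average \<phi> (1 - \<bar>X \<omega>\<bar>) * sym_average \<psi> (1 - \<bar>X \<omega>\<bar>)) * 1 * 1)"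
  proof (subst E)
    have "\<bar>sym_average \<phi> (1 - \<bar>t\<bar>) * sym_average \<psi> (1 - \<bar>t\<bar>)\<bar> \<le> B * C" if "\<bar>t\<bar> \<le> 1" for t
      unfolding abs_mult using B[of 0]
      by (intro mult_mono sym_average_bound B C r that) auto
    then show "(\<integral>x. indicator {-1<..<1} x * (2 * (1 - \<bar>x\<bar>))\<^sup>2 *
      (1 * sym_average \<phi> (1 - \<bar>x\<bar>) * sym_average \<psi> (1 - \<bar>x\<bar>)) \<partial>lborel) / measure lborel mixed_ball =
      (\<integral>(x, y, z). indicator mixed_ball (x, y, z) *
        (sym_average \<phi> (1 - \<bar>x\<bar>) * sym_average \<psi> (1 - \<bar>x\<bar>) * 1 * 1) \<partial>lborel) / measure lborel mixed_ball"
      by (subst integral_mixed_ball[where A="B * C" and B=1 and C=1]) auto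
  qed auto
  finally show ?thesis by simp
qed

lemma (in prob_space) cov_mixed_ball_pos:
  fixes X Y Z :: "'a \<Rightarrow> real" and f g :: "real \<Rightarrow> real"
  assumes meas [measurable]: "X \<in> borel_measurable M" "Y \<in> borel_measurable M" "Z \<in> borel_measurable M"
    and D: "distr M lborel (\<lambda>\<omega>. (X \<omega>, Y \<omega>, Z \<omega>)) = uniform_measure lborel mixed_ball"
    and f: "\<And>t. f (- t) = f t" "strict_mono_on {0..} f"
    and g: "\<And>t. g (- t) = g t" "strict_mono_on {0..} g"
  shows "cov (\<lambda>\<omega>. f (Y \<omega>)) (\<lambda>\<omega>. g (Z \<omega>)) > 0"
proof -
  let ?R = "\<lambda>\<omega>. 1 - \<bar>X \<omega>\<bar>"
  note fm = strict_mono_on_imp_mono_on[OF f(2)] and gm = strict_mono_on_imp_mono_on[OF g(2)]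
  have [measurable]: "f \<in> borel_measurable borel" "g \<in> borel_measurable borel"
    using even_mono_measurable f(1) fm g(1) gm by auto
  note fB = even_mono_bounded[OF f(1) fm] and gB = even_mono_bounded[OF g(1) gm]
  have T: "(\<lambda>\<omega>. (X \<omega>, Y \<omega>, Z \<omega>)) \<in> measurable M lborel"
    by simp
  have transfer: "AE \<omega> in M. P (X \<omega>)" if "AE p in lborel. p \<in> mixed_ball \<longrightarrow> P (fst p)" for P
    using AE_distrD[OF T, unfolded D, of "\<lambda>p. P (fst p)"] AE_uniform_measureI[OF _ that] by simp
  have "cov (\<lambda>\<omega>. sym_average f (?R \<omega>)) (\<lambda>\<omega>. sym_average g (?R \<omega>)) > 0"
  proof (rule cov_strict_mono_pos)
    show "strict_mono_on {0..1} (sym_average f)" "strict_mono_on {0..1} (sym_average g)"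
      by (rule strict_mono_sym_average, fact f, fact f, measurable, fact fB)
         (rule strict_mono_sym_average, fact g, fact g, measurable, fact gB)
    show "AE \<omega> in M. ?R \<omega> \<in> {0..1}"
      by (rule transfer) (auto simp: mixed_ball_def mixed_norm_def)
    fix r :: real
    have "AE x in lborel. 1 - \<bar>x\<bar> \<noteq> r"
      using AE_lborel_singleton[of "1 - r"] AE_lborel_singleton[of "r - 1"]
      by eventually_elim linarith
    then have "AE p in lborel \<Otimes>\<^sub>M (lborel :: (real \<times> real) measure). 1 - \<bar>fst p\<bar> \<noteq> r"
      by (intro lborel_pair.AE_pair_measure, measurable) auto
    then have "AE p in lborel. (p :: real \<times> real \<times> real) \<in> mixed_ball \<longrightarrow> 1 - \<bar>fst p\<bar> \<noteq> r"
      unfolding lborel_prod by eventually_elim simp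
    then show "AE \<omega> in M. ?R \<omega> \<noteq> r"
      by (rule transfer)
  qed auto
  also have "cov (\<lambda>\<omega>. sym_average f (?R \<omega>)) (\<lambda>\<omega>. sym_average g (?R \<omega>)) =
      cov (\<lambda>\<omega>. f (Y \<omega>)) (\<lambda>\<omega>. g (Z \<omega>))"
    unfolding cov_def
    using expectation_mixed_ball[OF meas D, where \<phi>=f and B="max \<bar>f 0\<bar> \<bar>f 1\<bar>" and \<psi>=g and C="max \<bar>g 0\<bar> \<bar>g 1\<bar>"]
      expectation_mixed_ball[OF meas D, where \<phi>=f and B="max \<bar>f 0\<bar> \<bar>f 1\<bar>" and \<psi>="\<lambda>_. 1" and C=1]
      expectation_mixed_ball[OF meas D, where \<phi>="\<lambda>_. 1" and B=1 and \<psi>=g and C="max \<bar>g 0\<bar> \<bar>g 1\<bar>"] fB gB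
    by simp
  finally show ?thesis .
qed

theorem mainTheorem9:
  fixes M :: "'a measure" and X Y Z :: "'a \<Rightarrow> real"
  assumes "prob_space M"
    and "X \<in> borel_measurable M" and "Y \<in> borel_measurable M" and "Z \<in> borel_measurable M"
    and "distr M lborel (\<lambda>\<omega>. (X \<omega>, Y \<omega>, Z \<omega>)) = uniform_measure lborel mixed_ball"
  shows "(\<forall>f g :: real \<Rightarrow> real.
            (\<forall>t. f (- t) = f t) \<and> (\<forall>t. g (- t) = g t) \<and>
            strict_mono_on {0..} f \<and> strict_mono_on {0..} g \<longrightarrow>
            prob_space.cov M (\<lambda>\<omega>. f (Y \<omega>)) (\<lambda>\<omega>. g (Z \<omega>)) > 0) \<and>
         prob_space.cov M (\<lambda>\<omega>. (Y \<omega>)\<^sup>2) (\<lambda>\<omega>. (Z \<omega>)\<^sup>2) > 0"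
proof -
  have "strict_mono_on {0..} (\<lambda>t :: real. t\<^sup>2)"
    by (intro strict_mono_onI) (auto intro: power_strict_mono)
  then have "prob_space.cov M (\<lambda>\<omega>. (Y \<omega>)\<^sup>2) (\<lambda>\<omega>. (Z \<omega>)\<^sup>2) > 0"
    using prob_space.cov_mixed_ball_pos[OF assms, of "\<lambda>t. t\<^sup>2" "\<lambda>t. t\<^sup>2"] by simp
  then show ?thesis
    using prob_space.cov_mixed_ball_pos[OF assms] by blast
qed

end
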